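(* If $D$ is a division ring, then every element of $\mathrm{M}_\infty(D)$ can be expressed as a product of two commutators in $\mathrm{M}_\infty(D)$.
   Context: $\mathrm{M}_\infty(D)=\bigcup_{n\ge1}\mathrm{M}_n(D)$ is the finitary matrix algebra over $D$: the union of the chain $\mathrm{M}_1(D)\subseteq \mathrm{M}_2(D)\subseteq\cdots$, where $\mathrm{M}_n(D)$ is embedded in $\mathrm{M}_{n+1}(D)$ by appending a zero row and a zero column, $A\mapsto\begin{pmatrix}A&0\\0&0\end{pmatrix}$. Equivalently, it consists of the countably infinite matrices over $D$ with only finitely many nonzero entries. A commutator in a ring $S$ is an element $[a,b]=ab-ba$ with $a,b\in S$. *)

theory Defs
  imports Main
begin

text \<open>
  A matrix in \<open>M\<^sub>\<infinity>(D)\<close> is its entry function, with rows and columns numbered from 0;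
  membership in \<open>M\<^sub>n(D)\<close> means that all entries outside the upper left
  \<open>n \<times> n\<close> block vanish, so the embeddings of the chain become inclusions.
\<close>

definition supp_block :: "nat \<Rightarrow> (nat \<Rightarrow> nat \<Rightarrow> 'a::zero) \<Rightarrow> bool" where
  "supp_block n A \<longleftrightarrow> (\<forall>i j. A i j \<noteq> 0 \<longrightarrow> i < n \<and> j < n)"

lemma supp_block_mono: "supp_block m A \<Longrightarrow> m \<le> n \<Longrightarrow> supp_block n A"
  unfolding supp_block_def by (meson less_le_trans)

typedef (overloaded) 'a finmat = "\<Union>n\<in>{1..}. {A :: nat \<Rightarrow> nat \<Rightarrow> 'a::zero. supp_block n A}"
  morphisms entry Finmat
  by (rule exI[of _ "\<lambda>i j. 0"]) (auto simp: supp_block_def)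

setup_lifting type_definition_finmat

lemma finmat_carrier_iff:
  "A \<in> (\<Union>n\<in>{1..}. {A. supp_block n A}) \<longleftrightarrow> (\<exists>n. supp_block n A)"
proof
  assume "\<exists>n. supp_block n A"
  then obtain n where "supp_block n A" by blast
  then have "supp_block (Suc n) A" by (rule supp_block_mono) simp
  then show "A \<in> (\<Union>n\<in>{1..}. {A. supp_block n A})" by force
qed auto

lemma supp_block_iff_finite:
  "(\<exists>n. supp_block n A) \<longleftrightarrow> finite {(i, j). A i j \<noteq> 0}"
proof
  assume "\<exists>n. supp_block n A"
  then obtain n where "supp_block n A" by blast
  then have "{(i, j). A i j \<noteq> 0} \<subseteq> {..<n} \<times> {..<n}"
    by (auto simp: supp_block_def)
  then show "finite {(i, j). A i j \<noteq> 0}"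
    by (rule finite_subset) simp
next
  assume fin: "finite {(i, j). A i j \<noteq> 0}"
  let ?S = "fst ` {(i, j). A i j \<noteq> 0} \<union> snd ` {(i, j). A i j \<noteq> 0}"
  have "finite ?S" using fin by blast
  then obtain n where n: "\<forall>k\<in>?S. k < n"
    using finite_nat_set_iff_bounded by blast
  have "supp_block n A"
    unfolding supp_block_def using n by force
  then show "\<exists>n. supp_block n A" ..
qed

lemma entry_supp_block: "\<exists>n. supp_block n (entry A)"
  using entry[of A] by blast

lemma supp_block_common:
  assumes "\<exists>n. supp_block n A" "\<exists>n. supp_block n B"
  obtains n where "supp_block n A" "supp_block n B"
proof -
  obtain m1 m2 where m: "supp_block m1 A" "supp_block m2 B" using assms by blast
  then have "supp_block (m1 + m2) A" "supp_block (m1 + m2) B"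
    by (auto elim: supp_block_mono)
  then show thesis by (rule that)
qed

text \<open>The index set of the sum is finite because each row of \<open>A\<close> is finitely supported.\<close>

definition mat_times ::
    "(nat \<Rightarrow> nat \<Rightarrow> 'a::semiring_0) \<Rightarrow> (nat \<Rightarrow> nat \<Rightarrow> 'a) \<Rightarrow> nat \<Rightarrow> nat \<Rightarrow> 'a" where
  "mat_times A B i j = (\<Sum>k | A i k \<noteq> 0. A i k * B k j)"

lemma mat_times_eq:
  assumes "supp_block n A"
  shows "mat_times A B i j = (\<Sum>k<n. A i k * B k j)"
  unfolding mat_times_def
  by (rule sum.mono_neutral_left) (use assms in \<open>auto simp: supp_block_def\<close>)

lemma supp_block_mat_times:
  assumes "supp_block n A" "supp_block n B"
  shows "supp_block n (mat_times A B)"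
  unfolding supp_block_def
proof (intro allI impI)
  fix i j assume "mat_times A B i j \<noteq> 0"
  then have "(\<Sum>k<n. A i k * B k j) \<noteq> 0" by (simp add: mat_times_eq[OF assms(1)])
  then obtain k where "A i k * B k j \<noteq> 0" by (meson sum.neutral)
  then have "A i k \<noteq> 0" "B k j \<noteq> 0" by auto
  then show "i < n \<and> j < n" using assms by (auto simp: supp_block_def)
qed

lemma supp_block_plus:
  fixes A B :: "nat \<Rightarrow> nat \<Rightarrow> 'a::monoid_add"
  assumes "supp_block n A" "supp_block n B"
  shows "supp_block n (\<lambda>i j. A i j + B i j)"
  unfolding supp_block_def
proof (intro allI impI)
  fix i j assume "A i j + B i j \<noteq> 0"
  then have "A i j \<noteq> 0 \<or> B i j \<noteq> 0" by auto
  then show "i < n \<and> j < n" using assms by (auto simp: supp_block_def)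
qed

lemma supp_block_minus:
  fixes A B :: "nat \<Rightarrow> nat \<Rightarrow> 'a::group_add"
  assumes "supp_block n A" "supp_block n B"
  shows "supp_block n (\<lambda>i j. A i j - B i j)"
  unfolding supp_block_def
proof (intro allI impI)
  fix i j assume "A i j - B i j \<noteq> 0"
  then have "A i j \<noteq> 0 \<or> B i j \<noteq> 0" by auto
  then show "i < n \<and> j < n" using assms by (auto simp: supp_block_def)
qed

instantiation finmat :: (ring) ring
begin

lift_definition zero_finmat :: "'a finmat" is "\<lambda>i j. 0"
  by (auto simp: supp_block_def)

lift_definition plus_finmat :: "'a finmat \<Rightarrow> 'a finmat \<Rightarrow> 'a finmat" is
  "\<lambda>A B i j. A i j + B i j"
  unfolding finmat_carrier_iff
  by (erule (1) supp_block_common) (rule exI, rule supp_block_plus)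

lift_definition minus_finmat :: "'a finmat \<Rightarrow> 'a finmat \<Rightarrow> 'a finmat" is
  "\<lambda>A B i j. A i j - B i j"
  unfolding finmat_carrier_iff
  by (erule (1) supp_block_common) (rule exI, rule supp_block_minus)

lift_definition uminus_finmat :: "'a finmat \<Rightarrow> 'a finmat" is "\<lambda>A i j. - A i j"
  by (simp add: supp_block_def)

lift_definition times_finmat :: "'a finmat \<Rightarrow> 'a finmat \<Rightarrow> 'a finmat" is mat_times
  unfolding finmat_carrier_iff
  by (erule (1) supp_block_common) (blast intro: supp_block_mat_times)

instance
proof
  fix A B C :: "'a finmat"
  obtain n1 n2 n3 where m: "supp_block n1 (entry A)" "supp_block n2 (entry B)"
      "supp_block n3 (entry C)"
    using entry_supp_block[of A] entry_supp_block[of B] entry_supp_block[of C] by blast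
  define n where "n = n1 + n2 + n3"
  have n: "supp_block n (entry A)" "supp_block n (entry B)" "supp_block n (entry C)"
    using m by (auto simp: n_def elim: supp_block_mono)
  note sum = supp_block_plus[OF n(1,2)]
  note eqs = mat_times_eq[OF n(1)] mat_times_eq[OF n(2)] mat_times_eq[OF n(3)]
    mat_times_eq[OF sum] mat_times_eq[OF supp_block_mat_times[OF n(1,2)]]
  have "entry (A * B * C) i j = entry (A * (B * C)) i j" for i j
  proof -
    have "entry (A * B * C) i j = (\<Sum>l<n. \<Sum>k<n. entry A i k * entry B k l * entry C l j)"
      by (simp add: times_finmat.rep_eq eqs sum_distrib_right)
    also have "\<dots> = (\<Sum>k<n. \<Sum>l<n. entry A i k * entry B k l * entry C l j)"
      by (rule sum.swap)
    also have "\<dots> = entry (A * (B * C)) i j"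
      by (simp add: times_finmat.rep_eq eqs sum_distrib_left mult.assoc)
    finally show ?thesis .
  qed
  then show "A * B * C = A * (B * C)" by (simp add: entry_inject[symmetric] fun_eq_iff)
  show "(A + B) * C = A * C + B * C"
    by (simp add: entry_inject[symmetric] fun_eq_iff times_finmat.rep_eq plus_finmat.rep_eq
        eqs distrib_right sum.distrib)
  show "A * (B + C) = A * B + A * C"
    by (simp add: entry_inject[symmetric] fun_eq_iff times_finmat.rep_eq plus_finmat.rep_eq
        eqs distrib_left sum.distrib)
qed (transfer; simp add: fun_eq_iff algebra_simps)+

end

definition is_commutator :: "'a::ring \<Rightarrow> bool" where
  "is_commutator x \<longleftrightarrow> (\<exists>a b. x = a * b - b * a)"

end

theory Submission
  imports Defs
begin

text \<open>
  View a matrix of \<open>M\<^sub>2\<^sub>n(D)\<close> as a \<open>2 \<times> 2\<close> block matrix and let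
  \<open>E\<^sub>i\<^sub>j\<close> be the block matrix units. An element \<open>A\<close> of \<open>M\<^sub>n(D)\<close> occupies the
  upper left block, so \<open>A = (A E\<^sub>1\<^sub>2) E\<^sub>2\<^sub>1\<close>. Both factors are block off-diagonal,
  hence commutators with \<open>E\<^sub>1\<^sub>1\<close>.
\<close>

text \<open>An \<open>n\<close> by \<open>n\<close> identity block with its upper left corner at
  \<open>(p, q)\<close>. The additive condition on \<open>j\<close> avoids truncated
  subtraction.\<close>

lift_definition shifted_id :: "nat \<Rightarrow> nat \<Rightarrow> nat \<Rightarrow> 'a::ring_1 finmat" is
  "\<lambda>n p q i j. if p \<le> i \<and> i < p + n \<and> j + p = i + q then 1 else 0"
  unfolding finmat_carrier_iff
proof -
  fix n p q :: nat
  show "\<exists>m. supp_block m (\<lambda>i j. if p \<le> i \<and> i < p + n \<and> j + p = i + q then 1 else (0::'a))"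
    by (rule exI[of _ "n + p + q"]) (auto simp: supp_block_def split: if_splits)
qed

lemma entry_times:
  assumes "supp_block n (entry X)"
  shows "entry (X * Y) i j = (\<Sum>k<n. entry X i k * entry Y k j)"
  by (simp add: times_finmat.rep_eq mat_times_eq[OF assms])

text \<open>Row \<open>i\<close> of the left factor has at most one nonzero entry, so the product
  only moves rows.\<close>

lemma entry_shifted_id_times:
  "entry (shifted_id n p q * X) i j =
    (if p \<le> i \<and> i < p + n then entry X (i - p + q) j else 0)"
proof (cases "p \<le> i \<and> i < p + n")
  case True
  then have "{k. entry (shifted_id n p q :: 'a finmat) i k \<noteq> 0} = {i - p + q}"
    by (auto simp: shifted_id.rep_eq)
  with True show ?thesis
    by (simp add: times_finmat.rep_eq mat_times_def shifted_id.rep_eq)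
next
  case False
  then show ?thesis
    by (auto simp: times_finmat.rep_eq mat_times_def shifted_id.rep_eq)
qed

lemma entry_times_shifted_id:
  "entry (X * shifted_id n p q) i j =
    (if q \<le> j \<and> j < q + n then entry X i (j - q + p) else 0)"
proof -
  obtain m where m: "supp_block m (entry X)"
    using entry_supp_block by blast
  have "entry (X * shifted_id n p q) i j =
      (\<Sum>k<m. if k = j - q + p then if q \<le> j \<and> j < q + n then entry X i k else 0 else 0)"
    unfolding entry_times[OF m] by (rule sum.cong) (auto simp: shifted_id.rep_eq)
  \<comment> \<open>If \<open>j - q + p\<close> lies beyond the summation range, \<open>X\<close>
    vanishes there by \<open>m\<close>.\<close>
  also have "\<dots> = (if q \<le> j \<and> j < q + n then entry X i (j - q + p) else 0)"
    using m by (auto simp: supp_block_def)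
  finally show ?thesis .
qed

lemma finmat_eqI: "(\<And>i j. entry X i j = entry Y i j) \<Longrightarrow> X = Y"
  by (simp add: entry_inject[symmetric] fun_eq_iff)

theorem theorem31:
  fixes A :: "'a::division_ring finmat"
  shows "\<exists>B C. is_commutator B \<and> is_commutator C \<and> A = B * C"
proof -
  obtain n where n: "supp_block n (entry A)"
    using entry_supp_block by blast
  have outside: "entry A i j = 0" if "n \<le> i \<or> n \<le> j" for i j
    using that n unfolding supp_block_def by (meson not_le)
  define E11 E12 E21 :: "'a finmat"
    where "E11 = shifted_id n 0 0" and "E12 = shifted_id n 0 n" and "E21 = shifted_id n n 0"
  note units = E11_def E12_def E21_def
  \<comment> \<open>\<open>E11\<close> fixes \<open>A * E12\<close> from the left and kills it from
    the right; for \<open>E21\<close> the sides are swapped, hence the opposite sign.\<close>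
  have "A * E12 = E11 * (A * E12) - (A * E12) * E11"
    by (rule finmat_eqI)
      (auto simp: units minus_finmat.rep_eq entry_shifted_id_times entry_times_shifted_id outside)
  moreover have "E21 = E21 * E11 - E11 * E21"
    by (rule finmat_eqI)
      (auto simp: units minus_finmat.rep_eq entry_shifted_id_times shifted_id.rep_eq)
  \<comment> \<open>\<open>E12 * E21 = E11\<close>, a right identity for \<open>A\<close>.\<close>
  moreover have "A = (A * E12) * E21"
    by (rule finmat_eqI) (auto simp: units entry_times_shifted_id outside)
  ultimately show ?thesis
    unfolding is_commutator_def by blast
qed

end
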